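(* There exist a CNA+ probability measure $\mu$ on $2^{[20]}$ and an integer $k$ such that $\mu(\{S:|S|=k\})\,\mu(\{S:|S|=k+1\})>0$ but $\mu_k\not\preccurlyeq\mu_{k+1}$.
   Context: Notation: $[n]=\{1,\dots,n\}$; the generating polynomial of a probability measure $\mu$ on $2^{[n]}$ is $g_\mu(z_1,\dots,z_n)=\sum_{S\subseteq[n]}\mu(S)\prod_{i\in S}z_i$. The truncation $\mu_k$ is the conditional probability measure of $\mu$ given $|S|=k$ (defined when $\mu(\{S:|S|=k\})>0$). Stochastic domination: $\mu\preccurlyeq\nu$ means $\mu(\mathcal{A})\le\nu(\mathcal{A})$ for every collection $\mathcal A$ of subsets of $[n]$ closed upwards under inclusion. CNA+: let $X_i(S)=1$ if $i\in S$ and $0$ otherwise. $\mu$ is NA if $\int F\,d\mu\int G\,d\mu\ge\int FG\,d\mu$ for all increasing functions $F,G$ on $2^{[n]}$ depending on disjoint sets of coordinates; CNA if each measure obtained from $\mu$ by conditioning on some (or none) of the values of the variables $X_i$ (on events of positive probability) is NA; CNA+ if each measure obtained from $\mu$ by imposing external fields and projections is CNA. Here imposing the external field $(a_1,\dots,a_n)$, $a_i\ge0$, gives the measure with generating polynomial $g_\mu(a_1z_1,\dots,a_nz_n)/g_\mu(a_1,\dots,a_n)$ (when the denominator is nonzero), and projection onto $2^{S}$ sets $z_i=1$ for $i\notin S$. *)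

theory Defs
  imports "HOL-Probability.Probability"
begin

text \<open>A probability measure on \<open>2\<^sup>E\<close>, for a finite ground set \<open>E\<close>, is a \<open>pmf\<close> on sets
  supported in \<open>Pow E\<close>. The ground set is carried along explicitly, because projections change it.\<close>

definition measure_on :: "'a set \<Rightarrow> 'a set pmf \<Rightarrow> bool" where
  "measure_on E \<mu> \<longleftrightarrow> set_pmf \<mu> \<subseteq> Pow E"

text \<open>The generating polynomial is represented by the function it induces on real points, which
  determines its coefficients.\<close>

definition gen_poly :: "'a set \<Rightarrow> 'a set pmf \<Rightarrow> ('a \<Rightarrow> real) \<Rightarrow> real" where
  "gen_poly E \<mu> z = (\<Sum>S\<in>Pow E. pmf \<mu> S * (\<Prod>i\<in>S. z i))"

definition truncation :: "'a set pmf \<Rightarrow> nat \<Rightarrow> 'a set pmf" where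
  "truncation \<mu> k = cond_pmf \<mu> {S. card S = k}"

definition stoch_dominated :: "'a set \<Rightarrow> 'a set pmf \<Rightarrow> 'a set pmf \<Rightarrow> bool" where
  "stoch_dominated E \<mu> \<nu> \<longleftrightarrow>
     (\<forall>\<A>. \<A> \<subseteq> Pow E \<and> (\<forall>S\<in>\<A>. \<forall>T\<in>Pow E. S \<subseteq> T \<longrightarrow> T \<in> \<A>) \<longrightarrow>
        measure_pmf.prob \<mu> \<A> \<le> measure_pmf.prob \<nu> \<A>)"

definition depends_only_on :: "'a set \<Rightarrow> 'a set \<Rightarrow> ('a set \<Rightarrow> real) \<Rightarrow> bool" where
  "depends_only_on E A F \<longleftrightarrow> (\<forall>S\<in>Pow E. \<forall>T\<in>Pow E. S \<inter> A = T \<inter> A \<longrightarrow> F S = F T)"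

definition NA :: "'a set \<Rightarrow> 'a set pmf \<Rightarrow> bool" where
  "NA E \<mu> \<longleftrightarrow>
     (\<forall>F G :: 'a set \<Rightarrow> real. \<forall>A B. A \<subseteq> E \<and> B \<subseteq> E \<and> A \<inter> B = {} \<and>
        mono_on (Pow E) F \<and> mono_on (Pow E) G \<and>
        depends_only_on E A F \<and> depends_only_on E B G \<longrightarrow>
        measure_pmf.expectation \<mu> F * measure_pmf.expectation \<mu> G
          \<ge> measure_pmf.expectation \<mu> (\<lambda>S. F S * G S))"

text \<open>The variable \<open>X\<^sub>i\<close> is encoded by the truth value of \<open>i \<in> S\<close>; \<open>C\<close> is the set of variables
  conditioned on and \<open>x\<close> their prescribed values.\<close>

definition CNA :: "'a set \<Rightarrow> 'a set pmf \<Rightarrow> bool" where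
  "CNA E \<mu> \<longleftrightarrow>
     (\<forall>C x. C \<subseteq> E \<and> measure_pmf.prob \<mu> {S. \<forall>i\<in>C. (i \<in> S) = x i} > 0 \<longrightarrow>
        NA E (cond_pmf \<mu> {S. \<forall>i\<in>C. (i \<in> S) = x i}))"

definition external_field :: "'a set \<Rightarrow> ('a \<Rightarrow> real) \<Rightarrow> 'a set pmf \<Rightarrow> 'a set pmf \<Rightarrow> bool" where
  "external_field E a \<mu> \<nu> \<longleftrightarrow>
     (\<forall>i\<in>E. a i \<ge> 0) \<and> gen_poly E \<mu> a \<noteq> 0 \<and> measure_on E \<nu> \<and>
     (\<forall>z. gen_poly E \<nu> z = gen_poly E \<mu> (\<lambda>i. a i * z i) / gen_poly E \<mu> a)"

definition projection :: "'a set \<Rightarrow> 'a set \<Rightarrow> 'a set pmf \<Rightarrow> 'a set pmf \<Rightarrow> bool" where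
  "projection E A \<mu> \<nu> \<longleftrightarrow>
     A \<subseteq> E \<and> measure_on A \<nu> \<and>
     (\<forall>z. gen_poly A \<nu> z = gen_poly E \<mu> (\<lambda>i. if i \<in> A then z i else 1))"

text \<open>The external fields and projections may be imposed any number of times and in any order.\<close>

inductive obtained_from :: "'a set \<Rightarrow> 'a set pmf \<Rightarrow> 'a set \<Rightarrow> 'a set pmf \<Rightarrow> bool"
  for E \<mu> where
  refl: "obtained_from E \<mu> E \<mu>"
| field: "obtained_from E \<mu> A \<nu> \<Longrightarrow> external_field A a \<nu> \<rho> \<Longrightarrow> obtained_from E \<mu> A \<rho>"
| proj: "obtained_from E \<mu> A \<nu> \<Longrightarrow> projection A B \<nu> \<rho> \<Longrightarrow> obtained_from E \<mu> B \<rho>"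

definition CNA_plus :: "'a set \<Rightarrow> 'a set pmf \<Rightarrow> bool" where
  "CNA_plus E \<mu> \<longleftrightarrow> (\<forall>A \<nu>. obtained_from E \<mu> A \<nu> \<longrightarrow> CNA A \<nu>)"

end

theory Submission
  imports Defs
begin

text \<open>Give \<open>S \<subseteq> {1..20}\<close> a weight that depends only on \<open>j = card (S - {20})\<close>, namely \<open>a j\<close> if
  \<open>20 \<notin> S\<close> and \<open>b j\<close> if \<open>20 \<in> S\<close>, where \<open>a = (1,1,1,1,0,\<dots>)\<close> and \<open>b = (3,2,1,0,\<dots>)\<close>. Given
  \<open>card S = 2\<close> the element 20 is present with probability 38/209 = 2/11, given \<open>card S = 3\<close> only with
  probability 171/1140 = 3/20, so domination fails.

  The measure is CNA+ because \<open>s * a + t * b\<close> is log-concave for all \<open>s, t \<ge> 0\<close> and \<open>b / a\<close> decreases.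
  External fields, projections and conditioning amount to a product weight with factors that may
  vanish. For disjoint \<open>A\<close>, \<open>B\<close> with \<open>20 \<notin> A\<close>, the mean of an increasing function of the coordinates
  outside \<open>A\<close> depends on \<open>S \<inter> A\<close> only through its size, and it decreases in that size, by induction
  on the number of coordinates. The mean of an increasing function of \<open>S \<inter> A\<close> given the size of
  \<open>S \<inter> A\<close> increases in that size, and Chebyshev's sum inequality gives negative association.\<close>

section \<open>Product weights and log-concave sequences\<close>

text \<open>An unnormalised law of independent coordinates. Absence carries its own factor
  \<open>q i\<close> instead of 1, so that a factor may vanish for either state of
  \<open>i\<close>.\<close>

definition prod_weight :: "('a \<Rightarrow> real) \<Rightarrow> ('a \<Rightarrow> real) \<Rightarrow> 'a set \<Rightarrow> 'a set \<Rightarrow> real" where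
  "prod_weight p q B S = (\<Prod>i\<in>B. if i \<in> S then p i else q i)"

lemma prod_weight_nonneg:
  assumes "\<And>i. i \<in> B \<Longrightarrow> 0 \<le> p i" "\<And>i. i \<in> B \<Longrightarrow> 0 \<le> q i"
  shows "0 \<le> prod_weight p q B S"
  using assms by (auto simp: prod_weight_def intro!: prod_nonneg)

lemma prod_weight_Un:
  assumes "finite A" "finite B" "A \<inter> B = {}" "S \<subseteq> A" "T \<subseteq> B"
  shows "prod_weight p q (A \<union> B) (S \<union> T) = prod_weight p q A S * prod_weight p q B T"
proof -
  have "prod_weight p q (A \<union> B) (S \<union> T) =
      (\<Prod>i\<in>A. if i \<in> S \<union> T then p i else q i) * (\<Prod>i\<in>B. if i \<in> S \<union> T then p i else q i)"
    unfolding prod_weight_def by (rule prod.union_disjoint) (use assms in auto)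
  also have "(\<Prod>i\<in>A. if i \<in> S \<union> T then p i else q i) = prod_weight p q A S"
    unfolding prod_weight_def by (rule prod.cong) (use assms in auto)
  also have "(\<Prod>i\<in>B. if i \<in> S \<union> T then p i else q i) = prod_weight p q B T"
    unfolding prod_weight_def by (rule prod.cong) (use assms in auto)
  finally show ?thesis .
qed

lemma sum_Pow_Un:
  assumes "A \<inter> B = {}"
  shows "(\<Sum>S\<in>Pow (A \<union> B). f S) = (\<Sum>S\<in>Pow A. \<Sum>T\<in>Pow B. f (S \<union> T))"
proof -
  have "(\<Sum>S\<in>Pow A. \<Sum>T\<in>Pow B. f (S \<union> T)) = (\<Sum>(S, T)\<in>Pow A \<times> Pow B. f (S \<union> T))"
    by (rule sum.cartesian_product)
  also have "\<dots> = (\<Sum>S\<in>Pow (A \<union> B). f S)"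
    by (rule sum.reindex_bij_witness[where i = "\<lambda>S. (S \<inter> A, S \<inter> B)" and j = "\<lambda>(S, T). S \<union> T"])
       (use assms in auto)
  finally show ?thesis by simp
qed

lemma sum_Pow_insert:
  assumes "e \<notin> B"
  shows "(\<Sum>S\<in>Pow (insert e B). f S) = (\<Sum>S\<in>Pow B. f S) + (\<Sum>S\<in>Pow B. f (insert e S))"
proof -
  have "Pow {e} = {{}, {e}}" by auto
  then show ?thesis
    using sum_Pow_Un[of "{e}" B f] assms by simp
qed

text \<open>The two-index form of log-concavity excludes internal zeros.\<close>

definition log_concave :: "(nat \<Rightarrow> real) \<Rightarrow> bool" where
  "log_concave w \<longleftrightarrow> (\<forall>i. 0 \<le> w i) \<and> (\<forall>i j. i \<le> j \<longrightarrow> w i * w (Suc j) \<le> w (Suc i) * w j)"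

lemma log_concaveD:
  assumes "log_concave w"
  shows "0 \<le> w i" "i \<le> j \<Longrightarrow> w i * w (Suc j) \<le> w (Suc i) * w j"
  using assms by (auto simp: log_concave_def)

text \<open>Both sides are compared with \<open>w (Suc i) * w (Suc j)\<close>. The second comparison
  needs \<open>Suc i \<le> j\<close>; for \<open>i = j\<close> the sides agree. Nothing is divided,
  so zeros of \<open>w\<close> are harmless.\<close>

lemma log_concave_far:
  assumes w: "log_concave w" and "i \<le> j"
  shows "w i * w (Suc (Suc j)) \<le> w (Suc (Suc i)) * w j"
proof (cases "i = j")
  case False
  have "w i * w (Suc (Suc j)) \<le> w (Suc i) * w (Suc j)"
    using log_concaveD(2)[OF w, of i "Suc j"] assms by simp
  also have "\<dots> \<le> w (Suc (Suc i)) * w j"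
    using log_concaveD(2)[OF w, of "Suc i" j] assms False by simp
  finally show ?thesis .
qed simp

text \<open>The effect of one more independent coordinate. The coefficients of \<open>q * q\<close>
  and \<open>p * p\<close> are log-concavity at \<open>(i, j)\<close> and
  \<open>(Suc i, Suc j)\<close>. In the coefficient of \<open>p * q\<close> the product
  \<open>w (Suc i) * w (Suc j)\<close> cancels and \<open>log_concave_far\<close> remains.\<close>

lemma log_concave_shift_combination:
  assumes w: "log_concave w" and "0 \<le> p" "0 \<le> q"
  shows "log_concave (\<lambda>i. q * w i + p * w (Suc i))"
proof -
  have "(q * w i + p * w (Suc i)) * (q * w (Suc j) + p * w (Suc (Suc j)))
      \<le> (q * w (Suc i) + p * w (Suc (Suc i))) * (q * w j + p * w (Suc j))" if "i \<le> j" for i j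
  proof -
    have 1: "q * q * (w i * w (Suc j)) \<le> q * q * (w (Suc i) * w j)"
      using log_concaveD(2)[OF w that] assms by (intro mult_left_mono) auto
    have 2: "p * p * (w (Suc i) * w (Suc (Suc j))) \<le> p * p * (w (Suc (Suc i)) * w (Suc j))"
      using log_concaveD(2)[OF w, of "Suc i" "Suc j"] that assms by (intro mult_left_mono) auto
    have 3: "p * q * (w i * w (Suc (Suc j))) \<le> p * q * (w (Suc (Suc i)) * w j)"
      using log_concave_far[OF w that] assms by (intro mult_left_mono) auto
    show ?thesis using 1 2 3 by (simp add: algebra_simps)
  qed
  then show ?thesis
    using log_concaveD(1)[OF w] assms by (auto simp: log_concave_def)
qed

section \<open>Monotonicity of conditional means\<close>

text \<open>\<open>layer_sum\<close> is the unnormalised mean, over a product weight on \<open>B\<close> and one further coordinate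
  with weights \<open>a\<close>, \<open>b\<close> for absent and present, of the function \<open>(G0, G1)\<close>, given that \<open>i\<close>
  elements outside \<open>B\<close> are present.\<close>

definition layer_sum :: "('a \<Rightarrow> real) \<Rightarrow> ('a \<Rightarrow> real) \<Rightarrow> (nat \<Rightarrow> real) \<Rightarrow> (nat \<Rightarrow> real) \<Rightarrow> 'a set \<Rightarrow>
    nat \<Rightarrow> ('a set \<Rightarrow> real) \<Rightarrow> ('a set \<Rightarrow> real) \<Rightarrow> real" where
  "layer_sum p q a b B i G0 G1 =
     (\<Sum>S\<in>Pow B. prod_weight p q B S * (a (i + card S) * G0 S + b (i + card S) * G1 S))"

abbreviation layer_mass where
  "layer_mass p q a b B i \<equiv> layer_sum p q a b B i (\<lambda>_. 1) (\<lambda>_. 1)"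

text \<open>The recursion behind the inductions on \<open>B\<close>: an absent \<open>e\<close>
  keeps the layer, a present \<open>e\<close> counts as one more element outside \<open>B\<close>
  and is inserted into the arguments of the functions.\<close>

lemma layer_sum_insert:
  assumes "finite B" "e \<notin> B"
  shows "layer_sum p q a b (insert e B) i G0 G1 =
    q e * layer_sum p q a b B i G0 G1
    + p e * layer_sum p q a b B (Suc i) (\<lambda>S. G0 (insert e S)) (\<lambda>S. G1 (insert e S))"
proof -
  have 1: "prod_weight p q (insert e B) S = q e * prod_weight p q B S" if "S \<subseteq> B" for S
    using prod_weight_Un[of "{e}" B "{}" S p q] assms that by (simp add: prod_weight_def)
  have 2: "prod_weight p q (insert e B) (insert e S) = p e * prod_weight p q B S" if "S \<subseteq> B" for S
    using prod_weight_Un[of "{e}" B "{e}" S p q] assms that by (simp add: prod_weight_def)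
  have 3: "card (insert e S) = Suc (card S)" if "S \<subseteq> B" for S
    using assms that by (subst card_insert_disjoint) (auto dest: finite_subset)
  show ?thesis
    unfolding layer_sum_def sum_Pow_insert[OF assms(2)] sum_distrib_left
    by (intro arg_cong2[where f = "(+)"] sum.cong) (auto simp: 1 2 3 algebra_simps)
qed

context
  fixes p q :: "'a \<Rightarrow> real" and a b :: "nat \<Rightarrow> real" and B :: "'a set"
  assumes fin: "finite B"
    and p_nonneg: "\<And>i. i \<in> B \<Longrightarrow> 0 \<le> p i" and q_nonneg: "\<And>i. i \<in> B \<Longrightarrow> 0 \<le> q i"
    and a_nonneg: "\<And>i. 0 \<le> a i" and b_nonneg: "\<And>i. 0 \<le> b i"
begin

lemma layer_sum_mono:
  assumes "\<And>S. S \<subseteq> B \<Longrightarrow> G0 S \<le> H0 S" "\<And>S. S \<subseteq> B \<Longrightarrow> G1 S \<le> H1 S"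
  shows "layer_sum p q a b B i G0 G1 \<le> layer_sum p q a b B i H0 H1"
  unfolding layer_sum_def
  by (intro sum_mono mult_left_mono add_mono prod_weight_nonneg)
     (use assms a_nonneg b_nonneg p_nonneg q_nonneg in auto)

text \<open>A vanishing sum of nonnegative terms has only zero terms, and \<open>a + b = 0\<close>
  forces both to vanish. This settles the layers of mass 0, where a mean is undefined.\<close>

lemma layer_sum_eq_0:
  assumes "layer_mass p q a b B i = 0"
  shows "layer_sum p q a b B i G0 G1 = 0"
  unfolding layer_sum_def
proof (rule sum.neutral, rule ballI)
  fix S assume S: "S \<in> Pow B"
  let ?w = "prod_weight p q B" and ?a = "\<lambda>S. a (i + card S)" and ?b = "\<lambda>S. b (i + card S)"
  have "\<forall>S\<in>Pow B. ?w S * (?a S * 1 + ?b S * 1) = 0"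
    using assms fin unfolding layer_sum_def
    by (subst (asm) sum_nonneg_eq_0_iff)
       (auto intro!: mult_nonneg_nonneg add_nonneg_nonneg prod_weight_nonneg
         a_nonneg b_nonneg p_nonneg q_nonneg)
  then have "?w S = 0 \<or> ?a S + ?b S = 0" using S by auto
  then show "?w S * (?a S * G0 S + ?b S * G1 S) = 0"
    using a_nonneg[of "i + card S"] b_nonneg[of "i + card S"]
    by (auto simp: add_nonneg_eq_0_iff)
qed

end

text \<open>Each coordinate of \<open>B\<close> acts by a shift combination, which preserves
  log-concavity; the empty \<open>B\<close> gives \<open>a + b\<close> itself.\<close>

lemma log_concave_layer_mass:
  assumes "finite B" "\<And>i. i \<in> B \<Longrightarrow> 0 \<le> p i" "\<And>i. i \<in> B \<Longrightarrow> 0 \<le> q i"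
    and "log_concave (\<lambda>i. a i + b i)"
  shows "log_concave (layer_mass p q a b B)"
  using assms(1-3)
proof (induction B rule: finite_induct)
  case empty
  then show ?case using assms(4) by (simp add: layer_sum_def prod_weight_def)
next
  case (insert e B)
  then have "log_concave (layer_mass p q a b B)" by simp
  from log_concave_shift_combination[OF this, of "p e" "q e"]
  moreover have "layer_mass p q a b (insert e B) =
      (\<lambda>i. q e * layer_mass p q a b B i + p e * layer_mass p q a b B (Suc i))"
    using insert.hyps by (auto simp: layer_sum_insert)
  ultimately show ?case using insert.prems by simp
qed

text \<open>One more element outside \<open>B\<close> lowers the mean; denominators are cleared.
  Induction on \<open>B\<close>: after expanding by the state of \<open>e\<close>, the coefficients
  of \<open>q e * q e\<close> and \<open>p e * p e\<close> are the induction hypotheses for the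
  functions without and with \<open>e\<close>, and the mixed coefficient is
  \<open>cross\<close>.\<close>

lemma layer_mean_Suc:
  assumes fin: "finite B" and p: "\<And>i. i \<in> B \<Longrightarrow> 0 \<le> p i" and q: "\<And>i. i \<in> B \<Longrightarrow> 0 \<le> q i"
    and a: "\<And>i. 0 \<le> a i" and b: "\<And>i. 0 \<le> b i"
    and lc: "log_concave (\<lambda>i. a i + b i)"
    and ratio: "\<And>i. b (Suc i) * a i \<le> b i * a (Suc i)"
    and G: "mono_on (Pow B) G0" "mono_on (Pow B) G1" "\<And>S. S \<subseteq> B \<Longrightarrow> G0 S \<le> G1 S"
  shows "layer_sum p q a b B (Suc i) G0 G1 * layer_mass p q a b B i
    \<le> layer_sum p q a b B i G0 G1 * layer_mass p q a b B (Suc i)"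
  using fin p q G
proof (induction B arbitrary: i G0 G1 rule: finite_induct)
  case empty
  \<comment> \<open>For empty \<open>B\<close> this product is exactly the right side minus the left
    side.\<close>
  have "0 \<le> (b i * a (Suc i) - b (Suc i) * a i) * (G1 {} - G0 {})"
    using ratio[of i] empty by (intro mult_nonneg_nonneg) auto
  then show ?case by (simp add: layer_sum_def prod_weight_def algebra_simps)
next
  case (insert e B)
  let ?L = "layer_sum p q a b B" and ?m = "layer_mass p q a b B"
  let ?H0 = "\<lambda>S. G0 (insert e S)" and ?H1 = "\<lambda>S. G1 (insert e S)"
  note nonneg = \<open>finite B\<close> insert.prems(1,2)[OF insertI2] a b
  have IH0: "?L (Suc i) G0 G1 * ?m i \<le> ?L i G0 G1 * ?m (Suc i)" for i
  proof (rule insert.IH)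
    show "mono_on (Pow B) G0" "mono_on (Pow B) G1"
      using insert.prems(3,4) by (auto elim!: mono_on_subset)
    show "G0 S \<le> G1 S" if "S \<subseteq> B" for S
      using insert.prems(5) that by auto
  qed (use insert.prems in auto)
  have IH1: "?L (Suc i) ?H0 ?H1 * ?m i \<le> ?L i ?H0 ?H1 * ?m (Suc i)" for i
  proof (rule insert.IH)
    show "mono_on (Pow B) ?H0" "mono_on (Pow B) ?H1"
      by (intro mono_onI mono_onD[OF insert.prems(3)] mono_onD[OF insert.prems(4)]; force)+
    show "?H0 S \<le> ?H1 S" if "S \<subseteq> B" for S
      using insert.prems(5)[of "insert e S"] that by auto
  qed (use insert.prems in auto)
  have lcm: "log_concave ?m"
    using log_concave_layer_mass[OF \<open>finite B\<close> _ _ lc] insert.prems by simp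
  have m: "0 \<le> ?m i" for i using log_concaveD(1)[OF lcm] .
  have GH: "?L (Suc i) G0 G1 \<le> ?L (Suc i) ?H0 ?H1"
    by (intro layer_sum_mono nonneg mono_onD[OF insert.prems(3)] mono_onD[OF insert.prems(4)]) auto
  have m3: "?m i * ?m (Suc (Suc i)) \<le> ?m (Suc i) * ?m (Suc i)"
    using log_concaveD(2)[OF lcm, of i "Suc i"] by simp
  have zero: "?L i G0 G1 = 0" if "?m i = 0" for i G0 G1
    by (rule layer_sum_eq_0[OF nonneg that])
  have cross: "?L (Suc i) G0 G1 * ?m (Suc i) + ?L (Suc (Suc i)) ?H0 ?H1 * ?m i
      \<le> ?L i G0 G1 * ?m (Suc (Suc i)) + ?L (Suc i) ?H0 ?H1 * ?m (Suc i)" (is "?l \<le> ?r")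
  proof (cases "?m (Suc i) = 0")
    case True
    \<comment> \<open>A zero mass at \<open>Suc i\<close> forces, by log-concavity, a zero mass at
      \<open>i\<close> or at \<open>Suc (Suc i)\<close>. Either way each product in
      \<open>cross\<close> has a vanishing factor.\<close>
    then have "?m i * ?m (Suc (Suc i)) \<le> 0"
      using m3 by simp
    then have "?m i * ?m (Suc (Suc i)) = 0"
      using mult_nonneg_nonneg[OF m[of i] m[of "Suc (Suc i)"]] by (rule order_antisym)
    then show ?thesis using True zero by auto
  next
    case False
    then have pos: "0 < ?m (Suc i)" using m[of "Suc i"] by simp
    have 1: "?L (Suc i) G0 G1 * ?m i * ?m (Suc (Suc i)) \<le> ?L i G0 G1 * ?m (Suc i) * ?m (Suc (Suc i))"
      by (intro mult_right_mono IH0 m)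
    have 2: "?L (Suc (Suc i)) ?H0 ?H1 * ?m (Suc i) * ?m i \<le> ?L (Suc i) ?H0 ?H1 * ?m (Suc (Suc i)) * ?m i"
      by (intro mult_right_mono IH1 m)
    \<comment> \<open>After multiplication by \<open>?m (Suc i)\<close> and use of both induction
      hypotheses, this product is what remains: the log-concavity gap of the masses times the gain
      from inserting \<open>e\<close>.\<close>
    have 3: "0 \<le> (?m (Suc i) * ?m (Suc i) - ?m i * ?m (Suc (Suc i))) *
        (?L (Suc i) ?H0 ?H1 - ?L (Suc i) G0 G1)"
      using m3 GH by (intro mult_nonneg_nonneg) auto
    have "?l * ?m (Suc i) \<le> ?r * ?m (Suc i)"
      using 1 2 3 by (simp add: algebra_simps)
    then show ?thesis using pos by simp
  qed
  have "p e * q e * ?l \<le> p e * q e * ?r"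
    using insert.prems(1,2) by (intro mult_left_mono[OF cross]) auto
  moreover have "q e * q e * (?L (Suc i) G0 G1 * ?m i) \<le> q e * q e * (?L i G0 G1 * ?m (Suc i))"
    by (intro mult_left_mono[OF IH0]) auto
  moreover have "p e * p e * (?L (Suc (Suc i)) ?H0 ?H1 * ?m (Suc i))
      \<le> p e * p e * (?L (Suc i) ?H0 ?H1 * ?m (Suc (Suc i)))"
    by (intro mult_left_mono[OF IH1]) auto
  ultimately show ?case
    unfolding layer_sum_insert[OF insert.hyps(1,2)] by (simp add: algebra_simps)
qed

text \<open>The one-step inequalities are chained. Transitivity of cross-multiplied fractions needs
  a positive middle mass; if that mass is 0, log-concavity makes the mass at one of the two ends 0,
  and both sides vanish.\<close>

lemma layer_mean_antimono:
  assumes fin: "finite B" and p: "\<And>i. i \<in> B \<Longrightarrow> 0 \<le> p i" and q: "\<And>i. i \<in> B \<Longrightarrow> 0 \<le> q i"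
    and a: "\<And>i. 0 \<le> a i" and b: "\<And>i. 0 \<le> b i"
    and lc: "log_concave (\<lambda>i. a i + b i)"
    and ratio: "\<And>i. b (Suc i) * a i \<le> b i * a (Suc i)"
    and G: "mono_on (Pow B) G0" "mono_on (Pow B) G1" "\<And>S. S \<subseteq> B \<Longrightarrow> G0 S \<le> G1 S"
    and "i \<le> j"
  shows "layer_sum p q a b B j G0 G1 * layer_mass p q a b B i
    \<le> layer_sum p q a b B i G0 G1 * layer_mass p q a b B j"
  using \<open>i \<le> j\<close>
proof (induction j rule: dec_induct)
  case (step n)
  let ?L = "\<lambda>i. layer_sum p q a b B i G0 G1" and ?m = "layer_mass p q a b B"
  note zero = layer_sum_eq_0[OF fin p q a b]
  have lcm: "log_concave ?m"
    using log_concave_layer_mass[OF fin p q lc] .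
  have m: "0 \<le> ?m i" for i using log_concaveD(1)[OF lcm] .
  show ?case
  proof (cases "?m n = 0")
    case True
    then have "?m i * ?m (Suc n) \<le> 0"
      using log_concaveD(2)[OF lcm, of i n] step by simp
    then have "?m i * ?m (Suc n) = 0"
      using mult_nonneg_nonneg[OF m[of i] m[of "Suc n"]] by (rule order_antisym)
    then show ?thesis using zero by auto
  next
    case False
    then have pos: "0 < ?m n" using m[of n] by simp
    have "?L (Suc n) * ?m i * ?m n = ?L (Suc n) * ?m n * ?m i" by simp
    also have "\<dots> \<le> ?L n * ?m (Suc n) * ?m i"
      by (intro mult_right_mono m layer_mean_Suc assms)
    also have "\<dots> = ?L n * ?m i * ?m (Suc n)" by simp
    also have "\<dots> \<le> ?L i * ?m n * ?m (Suc n)"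
      by (intro mult_right_mono m step.IH)
    finally have "?L (Suc n) * ?m i * ?m n \<le> ?L i * ?m (Suc n) * ?m n"
      by (simp add: algebra_simps)
    then show ?thesis using pos by simp
  qed
qed simp

section \<open>Negative association of almost exchangeable weights\<close>

text \<open>Chebyshev's inequality for \<open>f / r\<close> increasing and \<open>h / m\<close>
  decreasing, without division. By the Binet-Cauchy identity, twice the difference of the two sides
  is a double sum over \<open>i\<close>, \<open>j\<close> of products of two determinants, which
  have the same sign.\<close>

lemma chebyshev_ratio_sum:
  fixes f r h m :: "nat \<Rightarrow> real"
  assumes f: "\<And>i j. i \<le> j \<Longrightarrow> j \<le> N \<Longrightarrow> f i * r j \<le> f j * r i"
    and h: "\<And>i j. i \<le> j \<Longrightarrow> j \<le> N \<Longrightarrow> h j * m i \<le> h i * m j"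
  shows "(\<Sum>i\<le>N. f i * h i) * (\<Sum>i\<le>N. r i * m i) \<le> (\<Sum>i\<le>N. f i * m i) * (\<Sum>i\<le>N. r i * h i)"
proof -
  have nonneg: "0 \<le> (f i * r j - f j * r i) * (m i * h j - h i * m j)" if "i \<le> N" "j \<le> N" for i j
  proof (cases "i \<le> j")
    case True
    then show ?thesis using f[of i j] h[of i j] that
      by (intro mult_nonpos_nonpos) (auto simp: mult.commute)
  next
    case False
    then show ?thesis using f[of j i] h[of j i] that
      by (intro mult_nonneg_nonneg) (auto simp: mult.commute)
  qed
  let ?X = "(\<Sum>i\<le>N. f i * m i) * (\<Sum>i\<le>N. r i * h i)"
  let ?Y = "(\<Sum>i\<le>N. f i * h i) * (\<Sum>i\<le>N. r i * m i)"
  have "(\<Sum>i\<le>N. \<Sum>j\<le>N. (f i * r j - f j * r i) * (m i * h j - h i * m j)) =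
      (\<Sum>i\<le>N. \<Sum>j\<le>N. (f i * m i) * (r j * h j)) - (\<Sum>i\<le>N. \<Sum>j\<le>N. (f i * h i) * (r j * m j))
      - (\<Sum>i\<le>N. \<Sum>j\<le>N. (r i * m i) * (f j * h j)) + (\<Sum>i\<le>N. \<Sum>j\<le>N. (r i * h i) * (f j * m j))"
    by (simp add: sum.distrib[symmetric] sum_subtractf[symmetric] algebra_simps)
  also have "\<dots> = 2 * (?X - ?Y)"
    unfolding sum_product[symmetric] by (simp add: algebra_simps)
  finally have "2 * (?X - ?Y) = (\<Sum>i\<le>N. \<Sum>j\<le>N. (f i * r j - f j * r i) * (m i * h j - h i * m j))" ..
  moreover have "0 \<le> (\<Sum>i\<le>N. \<Sum>j\<le>N. (f i * r j - f j * r i) * (m i * h j - h i * m j))"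
    using nonneg by (intro sum_nonneg) auto
  ultimately show ?thesis by simp
qed

definition almost_exch :: "(nat \<Rightarrow> real) \<Rightarrow> (nat \<Rightarrow> real) \<Rightarrow> 'a \<Rightarrow> 'a set \<Rightarrow> real" where
  "almost_exch a b x S = (if x \<in> S then b (card (S - {x})) else a (card S))"

lemma sum_by_card:
  assumes "finite A"
  shows "(\<Sum>U\<in>Pow A. f U * h (card U)) =
    (\<Sum>i\<le>card A. (\<Sum>U | U \<subseteq> A \<and> card U = i. f U) * (h i :: real))"
proof -
  have "(\<Sum>U\<in>Pow A. f U * h (card U)) =
      (\<Sum>i\<le>card A. \<Sum>U | U \<in> Pow A \<and> card U = i. f U * h (card U))"
    using assms by (intro sum.group[symmetric]) (auto intro: card_mono)
  then show ?thesis by (simp add: sum_distrib_right)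
qed

text \<open>Efron's monotonicity theorem: the case of a point mass weight of \<open>layer_mean_antimono\<close>.\<close>

lemma slice_mean_mono:
  fixes F :: "'a set \<Rightarrow> real"
  assumes fin: "finite A" and p: "\<And>i. i \<in> A \<Longrightarrow> 0 \<le> p i" and q: "\<And>i. i \<in> A \<Longrightarrow> 0 \<le> q i"
    and F: "mono_on (Pow A) F" and "i \<le> j" "j \<le> card A"
  defines "r \<equiv> \<lambda>F i. \<Sum>U | U \<subseteq> A \<and> card U = i. prod_weight p q A U * F U"
  shows "r F i * r (\<lambda>_. 1) j \<le> r F j * r (\<lambda>_. 1) i"
proof -
  \<comment> \<open>With total size pinned to \<open>card A\<close>, layer \<open>card A - k\<close>
    selects the subsets of size \<open>k\<close>. This reverses the index, so the decreasing mean of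
    \<open>layer_mean_antimono\<close> becomes an increasing one.\<close>
  define \<delta> where "\<delta> = (\<lambda>k. of_bool (k = card A) :: real)"
  have r: "layer_sum p q \<delta> (\<lambda>_. 0) A (card A - k) F F = r F k" if "k \<le> card A" for k F
  proof -
    have "layer_sum p q \<delta> (\<lambda>_. 0) A (card A - k) F F =
        (\<Sum>U\<in>Pow A. if card U = k then prod_weight p q A U * F U else 0)"
      unfolding layer_sum_def by (rule sum.cong) (use that in \<open>auto simp: \<delta>_def\<close>)
    also have "\<dots> = (\<Sum>U | U \<in> Pow A \<and> card U = k. prod_weight p q A U * F U)"
      using fin by (subst sum.inter_filter[symmetric]) auto
    finally show ?thesis by (simp add: r_def)
  qed
  have "log_concave (\<lambda>i. \<delta> i + 0)"
    by (auto simp: log_concave_def \<delta>_def)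
  then have "layer_sum p q \<delta> (\<lambda>_. 0) A (card A - i) F F * layer_mass p q \<delta> (\<lambda>_. 0) A (card A - j)
      \<le> layer_sum p q \<delta> (\<lambda>_. 0) A (card A - j) F F * layer_mass p q \<delta> (\<lambda>_. 0) A (card A - i)"
    by (intro layer_mean_antimono) (use assms in \<open>auto simp: \<delta>_def\<close>)
  then show ?thesis using assms by (simp add: r)
qed

text \<open>The product weight factorises over \<open>A\<close> and its complement and cardinalities
  add, so the part in \<open>A\<close> enters the inner sum only through \<open>card U\<close>. The
  factors of \<open>x\<close> are absorbed into \<open>a\<close> and \<open>b\<close>.\<close>

lemma sum_almost_exch:
  fixes \<Phi> \<Gamma> :: "'a set \<Rightarrow> real"
  assumes fin: "finite E" and "x \<in> E" "A \<subseteq> E" "x \<notin> A"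
    and \<Phi>: "depends_only_on E A \<Phi>" and \<Gamma>: "depends_only_on E (E - A) \<Gamma>"
  shows "(\<Sum>S\<in>Pow E. prod_weight p q E S * almost_exch a b x S * (\<Phi> S * \<Gamma> S)) =
    (\<Sum>U\<in>Pow A. prod_weight p q A U * \<Phi> U *
       layer_sum p q (\<lambda>i. q x * a i) (\<lambda>i. p x * b i) (E - A - {x}) (card U)
         \<Gamma> (\<lambda>V. \<Gamma> (insert x V)))"
proof -
  define R where "R = E - A - {x}"
  have E: "E = A \<union> insert x R" and disj: "A \<inter> insert x R = {}" and xR: "x \<notin> R"
    using assms by (auto simp: R_def)
  have fin': "finite A" "finite R" using fin E by auto
  let ?f = "\<lambda>S. prod_weight p q E S * almost_exch a b x S * (\<Phi> S * \<Gamma> S)"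
  have w0: "prod_weight p q E (U \<union> V) = prod_weight p q A U * (q x * prod_weight p q R V)"
    if "U \<subseteq> A" "V \<subseteq> R" for U V
    using prod_weight_Un[of A "insert x R" U V p q] prod_weight_Un[of "{x}" R "{}" V p q]
      that fin' disj xR by (simp add: E subset_insertI2) (simp add: prod_weight_def)
  have w1: "prod_weight p q E (U \<union> insert x V) = prod_weight p q A U * (p x * prod_weight p q R V)"
    if "U \<subseteq> A" "V \<subseteq> R" for U V
    using prod_weight_Un[of A "insert x R" U "insert x V" p q]
      prod_weight_Un[of "{x}" R "{x}" V p q] that fin' disj xR
    by (simp add: E subset_insertI2 insert_mono) (simp add: prod_weight_def)
  have dep\<Phi>: "\<Phi> (U \<union> V) = \<Phi> U" if "U \<subseteq> A" "V \<subseteq> insert x R" for U V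
  proof -
    have "(U \<union> V) \<inter> A = U \<inter> A" "U \<union> V \<in> Pow E" "U \<in> Pow E" using that disj E by auto
    then show ?thesis using \<Phi> unfolding depends_only_on_def by blast
  qed
  have dep\<Gamma>: "\<Gamma> (U \<union> V) = \<Gamma> V" if "U \<subseteq> A" "V \<subseteq> insert x R" for U V
  proof -
    have "(U \<union> V) \<inter> (E - A) = V \<inter> (E - A)" "U \<union> V \<in> Pow E" "V \<in> Pow E" using that disj E by auto
    then show ?thesis using \<Gamma> unfolding depends_only_on_def by blast
  qed
  have c: "card (U \<union> V) = card U + card V" if "U \<subseteq> A" "V \<subseteq> R" for U V
    using that fin' disj by (intro card_Un_disjoint) (auto dest: finite_subset)
  have f0: "?f (U \<union> V) = prod_weight p q A U * \<Phi> U *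
      (prod_weight p q R V * (q x * a (card U + card V) * \<Gamma> V))" if "U \<subseteq> A" "V \<subseteq> R" for U V
  proof -
    have "x \<notin> U \<union> V" using that disj xR by auto
    moreover have "V \<subseteq> insert x R" using that by auto
    ultimately show ?thesis using that by (simp add: w0 dep\<Phi> dep\<Gamma> c almost_exch_def del: Un_iff)
  qed
  have f1: "?f (U \<union> insert x V) = prod_weight p q A U * \<Phi> U *
      (prod_weight p q R V * (p x * b (card U + card V) * \<Gamma> (insert x V)))"
    if "U \<subseteq> A" "V \<subseteq> R" for U V
  proof -
    have x: "x \<notin> U \<union> V" using that disj xR by auto
    then have "U \<union> insert x V - {x} = U \<union> V" by auto
    moreover have "insert x V \<subseteq> insert x R" using that by auto
    ultimately show ?thesis
      using that w1[of U V] dep\<Phi>[of U "insert x V"] dep\<Gamma>[of U "insert x V"] c[of U V]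
      by (simp add: almost_exch_def del: Un_insert_right)
  qed
  have "(\<Sum>S\<in>Pow E. ?f S) = (\<Sum>U\<in>Pow A. (\<Sum>V\<in>Pow R. ?f (U \<union> V)) + (\<Sum>V\<in>Pow R. ?f (U \<union> insert x V)))"
    by (subst E) (simp only: sum_Pow_Un[OF disj] sum_Pow_insert[OF xR])
  also have "\<dots> = (\<Sum>U\<in>Pow A. prod_weight p q A U * \<Phi> U *
      layer_sum p q (\<lambda>i. q x * a i) (\<lambda>i. p x * b i) R (card U) \<Gamma> (\<lambda>V. \<Gamma> (insert x V)))"
  proof (rule sum.cong[OF HOL.refl])
    fix U assume U: "U \<in> Pow A"
    have "(\<Sum>V\<in>Pow R. ?f (U \<union> V)) + (\<Sum>V\<in>Pow R. ?f (U \<union> insert x V)) =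
        (\<Sum>V\<in>Pow R. ?f (U \<union> V) + ?f (U \<union> insert x V))"
      by (rule sum.distrib[symmetric])
    also have "\<dots> = (\<Sum>V\<in>Pow R. prod_weight p q A U * \<Phi> U * (prod_weight p q R V *
        (q x * a (card U + card V) * \<Gamma> V + p x * b (card U + card V) * \<Gamma> (insert x V))))"
    proof (rule sum.cong[OF HOL.refl])
      fix V assume "V \<in> Pow R"
      then show "?f (U \<union> V) + ?f (U \<union> insert x V) = prod_weight p q A U * \<Phi> U * (prod_weight p q R V *
        (q x * a (card U + card V) * \<Gamma> V + p x * b (card U + card V) * \<Gamma> (insert x V)))"
        using U by (subst f0, simp, simp, subst f1, simp, simp) (simp only: distrib_left)
    qed
    finally show "(\<Sum>V\<in>Pow R. ?f (U \<union> V)) + (\<Sum>V\<in>Pow R. ?f (U \<union> insert x V)) =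
      prod_weight p q A U * \<Phi> U *
      layer_sum p q (\<lambda>i. q x * a i) (\<lambda>i. p x * b i) R (card U) \<Gamma> (\<lambda>V. \<Gamma> (insert x V))"
      by (simp only: layer_sum_def sum_distrib_left)
  qed
  finally show ?thesis by (simp only: R_def)
qed

text \<open>Grouping by the size of the part in \<open>A\<close> turns all four sums into sums of
  \<open>r \<Phi> i * L \<Gamma> i\<close>, with \<open>\<Phi>\<close> either \<open>F\<close> or 1
  and \<open>\<Gamma>\<close> either \<open>G\<close> or 1. The ratios \<open>r F / r 1\<close>
  increase and \<open>L G / L 1\<close> decrease, so \<open>chebyshev_ratio_sum\<close>
  applies.\<close>

lemma almost_exch_neg_assoc_aux:
  fixes F G :: "'a set \<Rightarrow> real"
  assumes fin: "finite E" and "x \<in> E"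
    and p: "\<And>i. i \<in> E \<Longrightarrow> 0 \<le> p i" and q: "\<And>i. i \<in> E \<Longrightarrow> 0 \<le> q i"
    and a: "\<And>i. 0 \<le> a i" and b: "\<And>i. 0 \<le> b i"
    and lc: "\<And>s t. 0 \<le> s \<Longrightarrow> 0 \<le> t \<Longrightarrow> log_concave (\<lambda>i. s * a i + t * b i)"
    and ratio: "\<And>i. b (Suc i) * a i \<le> b i * a (Suc i)"
    and AB: "A \<subseteq> E" "B \<subseteq> E" "A \<inter> B = {}" "x \<notin> A"
    and F: "mono_on (Pow E) F" "depends_only_on E A F"
    and G: "mono_on (Pow E) G" "depends_only_on E B G"
  defines "W \<equiv> \<lambda>S. prod_weight p q E S * almost_exch a b x S"
  shows "(\<Sum>S\<in>Pow E. W S * (F S * G S)) * (\<Sum>S\<in>Pow E. W S)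
    \<le> (\<Sum>S\<in>Pow E. W S * F S) * (\<Sum>S\<in>Pow E. W S * G S)"
proof -
  let ?w = "prod_weight p q A"
  define r where "r = (\<lambda>F i. \<Sum>U | U \<subseteq> A \<and> card U = i. ?w U * F U)"
  define L where "L = (\<lambda>\<Gamma> i. layer_sum p q (\<lambda>i. q x * a i) (\<lambda>i. p x * b i) (E - A - {x}) i
    \<Gamma> (\<lambda>V. \<Gamma> (insert x V)))"
  have finA: "finite A" using fin AB finite_subset by blast
  have px: "0 \<le> p x" "0 \<le> q x" using p q \<open>x \<in> E\<close> by auto
  have dep1: "depends_only_on E D (\<lambda>_. 1)" for D by (auto simp: depends_only_on_def)
  have depG: "depends_only_on E (E - A) G"
    unfolding depends_only_on_def
  proof (intro ballI impI)
    fix S T assume "S \<in> Pow E" "T \<in> Pow E" "S \<inter> (E - A) = T \<inter> (E - A)"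
    then have "S \<inter> B = T \<inter> B" using AB by blast
    then show "G S = G T"
      using G(2) \<open>S \<in> Pow E\<close> \<open>T \<in> Pow E\<close> unfolding depends_only_on_def by blast
  qed
  have sumW: "(\<Sum>S\<in>Pow E. W S * (\<Phi> S * \<Gamma> S)) = (\<Sum>i\<le>card A. r \<Phi> i * L \<Gamma> i)"
    if "depends_only_on E A \<Phi>" "depends_only_on E (E - A) \<Gamma>" for \<Phi> \<Gamma>
    unfolding W_def using sum_almost_exch[OF fin \<open>x \<in> E\<close> AB(1,4) that, of p q a b]
      sum_by_card[OF finA, of "\<lambda>U. ?w U * \<Phi> U" "L \<Gamma>"]
    by (simp add: r_def L_def)
  have "(\<Sum>i\<le>card A. r F i * L G i) * (\<Sum>i\<le>card A. r (\<lambda>_. 1) i * L (\<lambda>_. 1) i)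
      \<le> (\<Sum>i\<le>card A. r F i * L (\<lambda>_. 1) i) * (\<Sum>i\<le>card A. r (\<lambda>_. 1) i * L G i)"
  proof (rule chebyshev_ratio_sum)
    fix i j assume ij: "i \<le> j" "j \<le> card A"
    have "mono_on (Pow A) F" using F(1) AB(1) by (auto elim!: mono_on_subset)
    then show "r F i * r (\<lambda>_. 1) j \<le> r F j * r (\<lambda>_. 1) i"
      unfolding r_def using ij AB(1) by (intro slice_mean_mono finA p q) auto
    show "L G j * L (\<lambda>_. 1) i \<le> L G i * L (\<lambda>_. 1) j"
      unfolding L_def
    proof (rule layer_mean_antimono)
      show "mono_on (Pow (E - A - {x})) G"
        using G(1) by (auto elim!: mono_on_subset)
      show "mono_on (Pow (E - A - {x})) (\<lambda>V. G (insert x V))"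
        unfolding mono_on_def
        by (intro allI impI mono_onD[OF G(1)]) (use \<open>x \<in> E\<close> in auto)
      show "G S \<le> G (insert x S)" if "S \<subseteq> E - A - {x}" for S
        by (intro mono_onD[OF G(1)]) (use that \<open>x \<in> E\<close> in auto)
      \<comment> \<open>The factors at \<open>x\<close> rescale \<open>a\<close> and
        \<open>b\<close> separately; this is why every nonnegative combination has to be
        log-concave.\<close>
      show "log_concave (\<lambda>i. q x * a i + p x * b i)" using lc px by simp
      show "p x * b (Suc i) * (q x * a i) \<le> p x * b i * (q x * a (Suc i))" for i
        using mult_left_mono[OF ratio[of i], of "p x * q x"] px by (simp add: algebra_simps)
    qed (use fin p q a b px ij in auto)
  qed
  then show ?thesis
    using sumW[OF F(2) depG] sumW[OF F(2) dep1] sumW[OF dep1 depG] sumW[OF dep1 dep1] by simp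
qed

text \<open>The claim is symmetric under exchanging \<open>(A, F)\<close> and \<open>(B, G)\<close>,
  and \<open>x\<close> lies outside at least one of two disjoint sets.\<close>

lemma almost_exch_neg_assoc:
  fixes F G :: "'a set \<Rightarrow> real"
  assumes fin: "finite E" and "x \<in> E"
    and p: "\<And>i. i \<in> E \<Longrightarrow> 0 \<le> p i" and q: "\<And>i. i \<in> E \<Longrightarrow> 0 \<le> q i"
    and a: "\<And>i. 0 \<le> a i" and b: "\<And>i. 0 \<le> b i"
    and lc: "\<And>s t. 0 \<le> s \<Longrightarrow> 0 \<le> t \<Longrightarrow> log_concave (\<lambda>i. s * a i + t * b i)"
    and ratio: "\<And>i. b (Suc i) * a i \<le> b i * a (Suc i)"
    and AB: "A \<subseteq> E" "B \<subseteq> E" "A \<inter> B = {}"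
    and F: "mono_on (Pow E) F" "depends_only_on E A F"
    and G: "mono_on (Pow E) G" "depends_only_on E B G"
  defines "W \<equiv> \<lambda>S. prod_weight p q E S * almost_exch a b x S"
  shows "(\<Sum>S\<in>Pow E. W S * (F S * G S)) * (\<Sum>S\<in>Pow E. W S)
    \<le> (\<Sum>S\<in>Pow E. W S * F S) * (\<Sum>S\<in>Pow E. W S * G S)"
proof (cases "x \<in> A")
  case False
  then show ?thesis unfolding W_def using assms by (intro almost_exch_neg_assoc_aux)
next
  case True
  then have "x \<notin> B" "B \<inter> A = {}" using AB by auto
  then have "(\<Sum>S\<in>Pow E. W S * (G S * F S)) * (\<Sum>S\<in>Pow E. W S)
    \<le> (\<Sum>S\<in>Pow E. W S * G S) * (\<Sum>S\<in>Pow E. W S * F S)"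
    unfolding W_def
    by (intro almost_exch_neg_assoc_aux[where A = B and B = A] assms)
  then show ?thesis by (simp add: mult.commute)
qed

section \<open>External fields, projections and conditioning\<close>

lemma expectation_measure_on:
  assumes "finite A" "measure_on A \<nu>"
  shows "measure_pmf.expectation \<nu> F = (\<Sum>T\<in>Pow A. pmf \<nu> T * F T)"
  using assms
  by (subst integral_measure_pmf_real[of "Pow A"]) (auto simp: measure_on_def mult.commute)

lemma prob_measure_on:
  assumes "finite A" "measure_on A \<nu>"
  shows "measure_pmf.prob \<nu> X = (\<Sum>T\<in>Pow A. pmf \<nu> T * of_bool (T \<in> X))"
proof -
  have "measure_pmf.prob \<nu> X = measure_pmf.expectation \<nu> (indicator X)" by simp
  then show ?thesis
    by (simp only: expectation_measure_on[OF assms] indicator_def)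
qed

text \<open>At the indicator of \<open>T\<close> only the monomials of subsets of \<open>T\<close>
  survive. The proper subsets agree by induction, so the coefficient of \<open>T\<close> agrees as
  well.\<close>

lemma multiaffine_coeff_unique:
  fixes c d :: "'a set \<Rightarrow> real"
  assumes "finite A"
    and eq: "\<And>z :: 'a \<Rightarrow> real. (\<Sum>S\<in>Pow A. c S * (\<Prod>i\<in>S. z i)) = (\<Sum>S\<in>Pow A. d S * (\<Prod>i\<in>S. z i))"
    and "T \<subseteq> A"
  shows "c T = d T"
proof -
  have "finite T" using assms finite_subset by blast
  then show ?thesis using \<open>T \<subseteq> A\<close>
  proof (induction T rule: finite_psubset_induct)
    case (psubset T)
    have *: "(\<Sum>S\<in>Pow A. f S * (\<Prod>i\<in>S. of_bool (i \<in> T))) = (\<Sum>S\<in>Pow T - {T}. f S) + f T"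
      for f :: "'a set \<Rightarrow> real"
    proof -
      have "(\<Sum>S\<in>Pow A. f S * (\<Prod>i\<in>S. of_bool (i \<in> T))) = (\<Sum>S\<in>Pow T. f S * (\<Prod>i\<in>S. of_bool (i \<in> T)))"
      proof (rule sum.mono_neutral_right)
        show "\<forall>S\<in>Pow A - Pow T. f S * (\<Prod>i\<in>S. of_bool (i \<in> T)) = 0"
          using \<open>finite A\<close> by (auto simp: prod_zero_iff dest: finite_subset)
      qed (use \<open>finite A\<close> psubset.prems in auto)
      also have "\<dots> = (\<Sum>S\<in>Pow T. f S)"
      proof (rule sum.cong[OF HOL.refl])
        fix S assume "S \<in> Pow T"
        then have "(\<Prod>i\<in>S. of_bool (i \<in> T)) = (1 :: real)" by (intro prod.neutral) auto
        then show "f S * (\<Prod>i\<in>S. of_bool (i \<in> T)) = f S" by simp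
      qed
      also have "\<dots> = (\<Sum>S\<in>Pow T - {T}. f S) + f T"
        using \<open>finite T\<close> by (subst sum.remove[of _ T]) auto
      finally show ?thesis .
    qed
    have "(\<Sum>S\<in>Pow T - {T}. c S) = (\<Sum>S\<in>Pow T - {T}. d S)"
      using psubset by (intro sum.cong) auto
    then show ?case using eq[of "\<lambda>i. of_bool (i \<in> T)"] by (simp add: *)
  qed
qed

text \<open>A normal form for all chains of operations: a single external field \<open>c\<close> on
  \<open>E\<close>, followed by a single projection onto \<open>A\<close>, up to a constant
  \<open>Z\<close>.\<close>

lemma obtained_from_gen_poly:
  assumes "obtained_from E \<mu> A \<nu>" "measure_on E \<mu>"
  obtains c Z where "A \<subseteq> E" "measure_on A \<nu>" "\<And>i. i \<in> E \<Longrightarrow> 0 \<le> c i"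
    "\<And>z. gen_poly A \<nu> z = gen_poly E \<mu> (\<lambda>i. c i * (if i \<in> A then z i else 1)) / Z"
proof -
  have "\<exists>c Z. A \<subseteq> E \<and> measure_on A \<nu> \<and> (\<forall>i\<in>E. 0 \<le> c i) \<and>
    (\<forall>z. gen_poly A \<nu> z = gen_poly E \<mu> (\<lambda>i. c i * (if i \<in> A then z i else 1)) / Z)"
    using assms(1)
  proof induction
    case refl
    have "gen_poly E \<mu> z = gen_poly E \<mu> (\<lambda>i. 1 * (if i \<in> E then z i else 1)) / 1" for z
      unfolding gen_poly_def
      by (auto intro!: sum.cong arg_cong2[where f = "(*)"] prod.cong)
    then show ?case using assms(2)
      by (intro exI[of _ "\<lambda>_. 1"] exI[of _ 1]) auto
  next
    case (field A \<nu> a \<rho>)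
    then obtain c Z where IH: "A \<subseteq> E" "\<forall>i\<in>E. 0 \<le> c i"
      "\<And>z. gen_poly A \<nu> z = gen_poly E \<mu> (\<lambda>i. c i * (if i \<in> A then z i else 1)) / Z"
      by blast
    \<comment> \<open>The new field acts only on \<open>A\<close>; coordinates projected away
      earlier keep the factor they had.\<close>
    let ?c = "\<lambda>i. c i * (if i \<in> A then a i else 1)"
    have "(\<lambda>i. c i * (if i \<in> A then a i * z i else 1)) = (\<lambda>i. ?c i * (if i \<in> A then z i else 1))" for z
      by auto
    then have "gen_poly A \<rho> z = gen_poly E \<mu> (\<lambda>i. ?c i * (if i \<in> A then z i else 1)) / (Z * gen_poly A \<nu> a)" for z
      using field.hyps(2) IH(3)[of "\<lambda>i. a i * z i"] by (simp add: external_field_def)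
    then show ?case using IH field.hyps(2)
      by (intro exI[of _ ?c] exI[of _ "Z * gen_poly A \<nu> a"]) (auto simp: external_field_def)
  next
    case (proj A \<nu> B \<rho>)
    then obtain c Z where IH: "A \<subseteq> E" "\<forall>i\<in>E. 0 \<le> c i"
      "\<And>z. gen_poly A \<nu> z = gen_poly E \<mu> (\<lambda>i. c i * (if i \<in> A then z i else 1)) / Z"
      by blast
    have BA: "B \<subseteq> A" using proj.hyps(2) by (simp add: projection_def)
    then have "(\<lambda>i. c i * (if i \<in> A then (if i \<in> B then z i else 1) else 1))
        = (\<lambda>i. c i * (if i \<in> B then z i else 1))" for z
      by (intro ext) auto
    then have "gen_poly B \<rho> z = gen_poly E \<mu> (\<lambda>i. c i * (if i \<in> B then z i else 1)) / Z" for z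
      using proj.hyps(2) IH(3)[of "\<lambda>i. if i \<in> B then z i else 1"] by (simp add: projection_def)
    then show ?case using IH proj.hyps(2)
      by (intro exI[of _ c] exI[of _ Z]) (auto simp: projection_def)
  qed
  then show ?thesis using that by blast
qed

text \<open>Comparing coefficients shows that \<open>\<nu>\<close> is, up to \<open>Z\<close>, the
  image under intersection with \<open>A\<close> of \<open>\<mu>\<close> reweighted by
  \<open>prod c\<close>. Sums against \<open>\<nu>\<close> thus pull back to
  \<open>Pow E\<close>.\<close>

lemma sum_pmf_of_gen_poly:
  assumes "finite E" "A \<subseteq> E"
    and gen: "\<And>z. gen_poly A \<nu> z = gen_poly E \<mu> (\<lambda>i. c i * (if i \<in> A then z i else 1)) / Z"
  shows "(\<Sum>T\<in>Pow A. pmf \<nu> T * H T) = (\<Sum>S\<in>Pow E. pmf \<mu> S * prod c S * H (S \<inter> A)) / Z"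
proof -
  have finA: "finite A" using assms finite_subset by blast
  have group: "(\<Sum>T\<in>Pow A. (\<Sum>S | S \<in> Pow E \<and> S \<inter> A = T. pmf \<mu> S * prod c S) / Z * K T)
      = (\<Sum>S\<in>Pow E. pmf \<mu> S * prod c S * K (S \<inter> A)) / Z" for K
  proof -
    have "(\<Sum>S\<in>Pow E. pmf \<mu> S * prod c S * K (S \<inter> A)) =
        (\<Sum>T\<in>Pow A. \<Sum>S | S \<in> Pow E \<and> S \<inter> A = T. pmf \<mu> S * prod c S * K (S \<inter> A))"
      using \<open>finite E\<close> finA by (intro sum.group[symmetric]) auto
    also have "\<dots> = (\<Sum>T\<in>Pow A. (\<Sum>S | S \<in> Pow E \<and> S \<inter> A = T. pmf \<mu> S * prod c S) * K T)"
      by (simp add: sum_distrib_right)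
    finally show ?thesis by (simp add: sum_divide_distrib sum_distrib_right)
  qed
  have "pmf \<nu> T = (\<Sum>S | S \<in> Pow E \<and> S \<inter> A = T. pmf \<mu> S * prod c S) / Z" if "T \<subseteq> A" for T
  proof (rule multiaffine_coeff_unique[OF finA _ that])
    fix z :: "'a \<Rightarrow> real"
    have "(\<Prod>i\<in>S. c i * (if i \<in> A then z i else 1)) = prod c S * prod z (S \<inter> A)" if "S \<in> Pow E" for S
    proof -
      have "finite S" using that \<open>finite E\<close> finite_subset by auto
      then show ?thesis by (simp add: prod.distrib prod.inter_restrict)
    qed
    then have "gen_poly A \<nu> z = (\<Sum>S\<in>Pow E. pmf \<mu> S * prod c S * prod z (S \<inter> A)) / Z"
      unfolding gen by (simp add: gen_poly_def mult.assoc)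
    also have "\<dots> = (\<Sum>T\<in>Pow A. (\<Sum>S | S \<in> Pow E \<and> S \<inter> A = T. pmf \<mu> S * prod c S) / Z * prod z T)"
      by (rule group[symmetric])
    finally show "(\<Sum>S\<in>Pow A. pmf \<nu> S * prod z S) =
        (\<Sum>T\<in>Pow A. (\<Sum>S | S \<in> Pow E \<and> S \<inter> A = T. pmf \<mu> S * prod c S) / Z * prod z T)"
      by (simp add: gen_poly_def)
  qed
  then have "(\<Sum>T\<in>Pow A. pmf \<nu> T * H T) =
      (\<Sum>T\<in>Pow A. (\<Sum>S | S \<in> Pow E \<and> S \<inter> A = T. pmf \<mu> S * prod c S) / Z * H T)"
    by (intro sum.cong) auto
  then show ?thesis using group by simp
qed

lemma pmf_cond_positive:
  assumes "measure_pmf.prob \<nu> X > 0"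
  shows "pmf (cond_pmf \<nu> X) T = pmf \<nu> T * of_bool (T \<in> X) / measure_pmf.prob \<nu> X"
proof -
  have "set_pmf \<nu> \<inter> X \<noteq> {}"
    using assms measure_Int_set_pmf[of \<nu> X] by (auto simp: Int_commute)
  then show ?thesis by (simp add: pmf_cond)
qed

lemma measure_on_cond:
  assumes "measure_on A \<nu>" "measure_pmf.prob \<nu> X > 0"
  shows "measure_on A (cond_pmf \<nu> X)"
  using assms unfolding measure_on_def
  by (auto simp: set_pmf_eq pmf_cond_positive subset_iff)

text \<open>Conditioning is absorbed into the product weight: \<open>q i = 0\<close> forces \<open>i\<close> to be present and
  \<open>p i = 0\<close> forces it to be absent.\<close>

lemma CNA_plus_almost_exch:
  fixes E :: "'a set"
  assumes fin: "finite E" and "x \<in> E"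
    and a: "\<And>i. 0 \<le> a i" and b: "\<And>i. 0 \<le> b i"
    and lc: "\<And>s t. 0 \<le> s \<Longrightarrow> 0 \<le> t \<Longrightarrow> log_concave (\<lambda>i. s * a i + t * b i)"
    and ratio: "\<And>i. b (Suc i) * a i \<le> b i * a (Suc i)"
    and \<mu>: "measure_on E \<mu>" "\<And>S. S \<subseteq> E \<Longrightarrow> pmf \<mu> S = almost_exch a b x S / Z0"
  shows "CNA_plus E \<mu>"
  unfolding CNA_plus_def CNA_def
proof (intro allI impI)
  fix A C :: "'a set" and \<nu> v
  assume "obtained_from E \<mu> A \<nu>"
  from obtained_from_gen_poly[OF this \<mu>(1)] obtain c Z where AE: "A \<subseteq> E" and \<nu>: "measure_on A \<nu>"
    and c: "\<And>i. i \<in> E \<Longrightarrow> 0 \<le> c i"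
    and gen: "\<And>z. gen_poly A \<nu> z = gen_poly E \<mu> (\<lambda>i. c i * (if i \<in> A then z i else 1)) / Z"
    by blast
  define X where "X = {S. \<forall>i\<in>C. (i \<in> S) = v i}"
  assume "C \<subseteq> A \<and> measure_pmf.prob \<nu> {S. \<forall>i\<in>C. (i \<in> S) = v i} > 0"
  then have CA: "C \<subseteq> A" and pos: "measure_pmf.prob \<nu> X > 0" by (auto simp: X_def)
  define p where "p = (\<lambda>i. if i \<in> C \<and> \<not> v i then 0 else c i)"
  define q :: "'a \<Rightarrow> real" where "q = (\<lambda>i. if i \<in> C \<and> v i then 0 else 1)"
  define W where "W = (\<lambda>S. prod_weight p q E S * almost_exch a b x S)"
  define K where "K = Z0 * Z * measure_pmf.prob \<nu> X"
  have finA: "finite A" using AE fin finite_subset by blast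
  have pw: "prod_weight p q E S = prod c S * of_bool (S \<inter> A \<in> X)" if "S \<subseteq> E" for S
  proof (cases "S \<inter> A \<in> X")
    case True
    then have "prod_weight p q E S = (\<Prod>i\<in>E. if i \<in> S then c i else 1)"
      unfolding prod_weight_def using CA by (intro prod.cong) (auto simp: p_def q_def X_def)
    also have "\<dots> = prod c S"
      using fin that by (simp add: prod.inter_restrict[symmetric] Int_absorb1)
    finally show ?thesis using True by simp
  next
    case False
    then obtain i where "i \<in> C" "(i \<in> S) \<noteq> v i" using CA by (auto simp: X_def)
    then have "\<exists>i\<in>E. (if i \<in> S then p i else q i) = 0"
      using CA AE by (intro bexI[of _ i]) (auto simp: p_def q_def)
    then show ?thesis using False fin by (simp add: prod_weight_def)
  qed
  \<comment> \<open>Field, projection and conditioning are now all contained in the weight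
    \<open>W\<close> on the original ground set.\<close>
  have expect: "measure_pmf.expectation (cond_pmf \<nu> X) H = (\<Sum>S\<in>Pow E. W S * H (S \<inter> A)) / K" for H
  proof -
    have "measure_pmf.expectation (cond_pmf \<nu> X) H =
        (\<Sum>T\<in>Pow A. pmf \<nu> T * (of_bool (T \<in> X) * H T / measure_pmf.prob \<nu> X))"
      by (subst expectation_measure_on[OF finA measure_on_cond[OF \<nu> pos]])
         (simp add: pmf_cond_positive[OF pos] algebra_simps)
    also have "\<dots> = (\<Sum>S\<in>Pow E. pmf \<mu> S * prod c S *
        (of_bool (S \<inter> A \<in> X) * H (S \<inter> A) / measure_pmf.prob \<nu> X)) / Z"
      by (rule sum_pmf_of_gen_poly[OF fin AE gen])
    also have "\<dots> = (\<Sum>S\<in>Pow E. W S * H (S \<inter> A) / K)"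
      unfolding sum_divide_distrib
      by (intro sum.cong) (auto simp: W_def pw \<mu>(2) K_def mult_ac)
    finally show ?thesis by (simp only: sum_divide_distrib)
  qed
  have W_nonneg: "0 \<le> (\<Sum>S\<in>Pow E. W S)"
    unfolding W_def using a b c
    by (intro sum_nonneg mult_nonneg_nonneg prod_weight_nonneg)
       (auto simp: p_def q_def almost_exch_def)
  \<comment> \<open>Total mass 1 together with \<open>W_nonneg\<close> gives \<open>K > 0\<close>,
    so the signs of \<open>Z0\<close> and \<open>Z\<close> need no tracking.\<close>
  have "(\<Sum>S\<in>Pow E. W S) / K = 1"
    using expect[of "\<lambda>_. 1"] by simp
  then have K: "(\<Sum>S\<in>Pow E. W S) = K" "K > 0"
    using W_nonneg by (auto simp: divide_eq_1_iff less_le)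
  show "NA A (cond_pmf \<nu> {S. \<forall>i\<in>C. (i \<in> S) = v i})"
    unfolding NA_def X_def[symmetric]
  proof (intro allI impI, elim conjE)
    fix F G :: "'a set \<Rightarrow> real" and A1 B1
    assume A1: "A1 \<subseteq> A" "B1 \<subseteq> A" "A1 \<inter> B1 = {}" and mono: "mono_on (Pow A) F" "mono_on (Pow A) G"
      and dep: "depends_only_on A A1 F" "depends_only_on A B1 G"
    \<comment> \<open>Pulling back along intersection with \<open>A\<close> preserves monotonicity
      and the dependence sets, so negative association on \<open>A\<close> is read off on
      \<open>E\<close>.\<close>
    have mono': "mono_on (Pow E) (\<lambda>S. H (S \<inter> A))" if "mono_on (Pow A) H" for H :: "'a set \<Rightarrow> real"
      by (intro mono_onI mono_onD[OF that]) auto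
    have dep': "depends_only_on E D (\<lambda>S. H (S \<inter> A))" if "depends_only_on A D H" for D and H :: "'a set \<Rightarrow> real"
      unfolding depends_only_on_def
    proof (intro ballI impI)
      fix S T assume "S \<inter> D = T \<inter> D"
      then have "S \<inter> A \<inter> D = T \<inter> A \<inter> D" by blast
      then show "H (S \<inter> A) = H (T \<inter> A)"
        using that unfolding depends_only_on_def by blast
    qed
    have "(\<Sum>S\<in>Pow E. W S * (F (S \<inter> A) * G (S \<inter> A))) * (\<Sum>S\<in>Pow E. W S)
        \<le> (\<Sum>S\<in>Pow E. W S * F (S \<inter> A)) * (\<Sum>S\<in>Pow E. W S * G (S \<inter> A))"
      unfolding W_def
      by (intro almost_exch_neg_assoc[where A = A1 and B = B1] fin \<open>x \<in> E\<close> a b lc ratio mono' dep' mono dep A1)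
         (use AE A1 c in \<open>auto simp: p_def q_def\<close>)
    then show "measure_pmf.expectation (cond_pmf \<nu> X) (\<lambda>S. F S * G S)
        \<le> measure_pmf.expectation (cond_pmf \<nu> X) F * measure_pmf.expectation (cond_pmf \<nu> X) G"
      unfolding expect K(1) using K(2) by (simp add: field_simps)
  qed
qed

section \<open>The counterexample\<close>

lemma exists_pmf_proportional:
  fixes u :: "'a \<Rightarrow> real"
  assumes "finite X" "\<And>S. S \<in> X \<Longrightarrow> 0 \<le> u S" "0 < sum u X"
  obtains \<mu> where "\<And>S. pmf \<mu> S = (if S \<in> X then u S / sum u X else 0)"
proof -
  let ?f = "\<lambda>S. if S \<in> X then u S / sum u X else 0"
  have "(\<integral>\<^sup>+S. ennreal (?f S) \<partial>count_space UNIV) = (\<Sum>S\<in>X. ennreal (?f S))"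
    using assms by (intro nn_integral_count_space') auto
  also have "\<dots> = ennreal (\<Sum>S\<in>X. ?f S)"
    using assms by (intro sum_ennreal) auto
  also have "(\<Sum>S\<in>X. ?f S) = 1"
    using assms by (simp add: sum_divide_distrib[symmetric])
  finally have "(\<integral>\<^sup>+S. ennreal (?f S) \<partial>count_space UNIV) = 1" by simp
  then have "pmf (embed_pmf ?f) S = ?f S" for S
    using assms by (intro pmf_embed_pmf) auto
  then show ?thesis using that by blast
qed

lemma sum_Pow_card:
  assumes "finite R"
  shows "(\<Sum>S\<in>Pow R. c * of_bool (card S = k)) = (c :: real) * real (card R choose k)"
proof -
  have "(\<Sum>S\<in>Pow R. c * of_bool (card S = k)) = (\<Sum>S\<in>Pow R. if card S = k then c else 0)"
    by (intro sum.cong) auto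
  also have "\<dots> = (\<Sum>S | S \<in> Pow R \<and> card S = k. c)"
    using assms by (simp only: sum.inter_filter finite_Pow_iff)
  finally have "(\<Sum>S\<in>Pow R. c * of_bool (card S = k)) = (\<Sum>S | S \<in> Pow R \<and> card S = k. c)" .
  then show ?thesis using n_subsets[OF assms, of k] by simp
qed

text \<open>A set of size \<open>Suc k\<close> has \<open>k\<close> elements in \<open>R\<close> if
  it contains \<open>x\<close> and \<open>Suc k\<close> otherwise, hence the different indices of
  \<open>b\<close> and \<open>a\<close>.\<close>

lemma sum_almost_exch_card:
  assumes "finite R" "x \<notin> R"
  shows "(\<Sum>S\<in>Pow (insert x R). almost_exch a b x S * of_bool (card S = Suc k \<and> x \<in> S))
      = b k * real (card R choose k)"
    and "(\<Sum>S\<in>Pow (insert x R). almost_exch a b x S * of_bool (card S = Suc k))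
      = a (Suc k) * real (card R choose Suc k) + b k * real (card R choose k)"
proof -
  have c: "card (insert x S) = Suc (card S)" "insert x S - {x} = S" "x \<notin> S" if "S \<subseteq> R" for S
  proof -
    show "x \<notin> S" using assms(2) that by blast
    then show "card (insert x S) = Suc (card S)" "insert x S - {x} = S"
      using finite_subset[OF that assms(1)] by auto
  qed
  have 1: "(\<Sum>S\<in>Pow R. almost_exch a b x (insert x S) * of_bool (card (insert x S) = Suc k))
      = (\<Sum>S\<in>Pow R. b k * of_bool (card S = k))"
    by (rule sum.cong) (auto simp: almost_exch_def c)
  have 2: "(\<Sum>S\<in>Pow R. almost_exch a b x S * of_bool (card S = Suc k))
      = (\<Sum>S\<in>Pow R. a (Suc k) * of_bool (card S = Suc k))"
    by (rule sum.cong) (auto simp: almost_exch_def c)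
  have 3: "(\<Sum>S\<in>Pow R. almost_exch a b x S * of_bool (card S = Suc k \<and> x \<in> S)) = 0"
    by (rule sum.neutral) (auto simp: c)
  show "(\<Sum>S\<in>Pow (insert x R). almost_exch a b x S * of_bool (card S = Suc k))
      = a (Suc k) * real (card R choose Suc k) + b k * real (card R choose k)"
    unfolding sum_Pow_insert[OF assms(2)] 1 2 sum_Pow_card[OF assms(1)] ..
  show "(\<Sum>S\<in>Pow (insert x R). almost_exch a b x S * of_bool (card S = Suc k \<and> x \<in> S))
      = b k * real (card R choose k)"
    unfolding sum_Pow_insert[OF assms(2)] 3 using 1 sum_Pow_card[OF assms(1)] by simp
qed

text \<open>The values are \<open>s + 3 * t\<close>, \<open>s + 2 * t\<close>, \<open>s + t\<close>,
  \<open>s\<close> and then 0: an arithmetic progression cut off. For \<open>j \<ge> 3\<close> the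
  left side is 0, which leaves six pairs to check.\<close>

lemma log_concave_truncated_linear:
  assumes "0 \<le> s" "0 \<le> t"
  shows "log_concave (\<lambda>k. s * of_bool (k \<le> 3) + t * real (3 - k))"
proof -
  let ?w = "\<lambda>k. s * of_bool (k \<le> 3) + t * real (3 - k)"
  have "?w i * ?w (Suc j) \<le> ?w (Suc i) * ?w j" if "i \<le> j" for i j
  proof (cases "j < 3")
    case True
    then have "i = 0 \<and> j = 0 \<or> i = 0 \<and> j = 1 \<or> i = 0 \<and> j = 2 \<or> i = 1 \<and> j = 1 \<or>
        i = 1 \<and> j = 2 \<or> i = 2 \<and> j = 2"
      using that by linarith
    then show ?thesis
      using assms mult_nonneg_nonneg[OF assms] mult_nonneg_nonneg[OF assms(1,1)]
        mult_nonneg_nonneg[OF assms(2,2)]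
      by (elim disjE conjE) (simp_all add: algebra_simps)
  next
    case False
    then show ?thesis using assms by simp
  qed
  then show ?thesis using assms by (auto simp: log_concave_def)
qed

theorem mainTheorem10:
  shows "\<exists>(\<mu> :: nat set pmf) (k :: nat).
    measure_on {1..20} \<mu> \<and> CNA_plus {1..20} \<mu> \<and>
    measure_pmf.prob \<mu> {S. card S = k} * measure_pmf.prob \<mu> {S. card S = k + 1} > 0 \<and>
    \<not> stoch_dominated {1..20} (truncation \<mu> k) (truncation \<mu> (k + 1))"
proof -
  define E :: "nat set" where "E = {1..20}"
  define a :: "nat \<Rightarrow> real" where "a = (\<lambda>k. of_bool (k \<le> 3))"
  \<comment> \<open>Subtraction on naturals truncates, so \<open>b\<close> is 0 from index 3
    on.\<close>
  define b :: "nat \<Rightarrow> real" where "b = (\<lambda>k. real (3 - k))"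
  let ?u = "almost_exch a b (20 :: nat)"
  define Z where "Z = sum ?u (Pow E)"
  have E: "finite E" "20 \<in> E" "E = insert 20 {1..19}" by (auto simp: E_def)
  have u_nonneg: "0 \<le> ?u S" for S by (simp add: almost_exch_def a_def b_def)
  \<comment> \<open>The empty set has weight \<open>a 0 = 1\<close>, so the normalising constant is
    positive.\<close>
  have "?u {} \<le> Z"
    unfolding Z_def using E u_nonneg by (intro member_le_sum) auto
  then have Z: "Z > 0" by (simp add: almost_exch_def a_def)
  obtain \<mu> where \<mu>: "\<And>S. pmf \<mu> S = (if S \<in> Pow E then ?u S / Z else 0)"
    using exists_pmf_proportional[of "Pow E" ?u] E u_nonneg Z unfolding Z_def by auto
  have on: "measure_on E \<mu>"
    by (auto simp: measure_on_def set_pmf_eq \<mu> split: if_splits)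
  have cna: "CNA_plus E \<mu>"
  proof (rule CNA_plus_almost_exch[OF E(1,2) _ _ _ _ on])
    show "log_concave (\<lambda>i. s * a i + t * b i)" if "0 \<le> s" "0 \<le> t" for s t
      using log_concave_truncated_linear[OF that] by (simp add: a_def b_def)
    show "b (Suc i) * a i \<le> b i * a (Suc i)" for i by (simp add: a_def b_def)
  qed (auto simp: \<mu> a_def b_def)
  have prob: "measure_pmf.prob \<mu> X = (\<Sum>S\<in>Pow E. ?u S * of_bool (S \<in> X)) / Z" for X
    by (subst prob_measure_on[OF E(1) on]) (simp add: \<mu> sum_divide_distrib)
  let ?N = "\<lambda>k. \<Sum>S\<in>Pow E. ?u S * of_bool (card S = k)"
  let ?M = "\<lambda>k. \<Sum>S\<in>Pow E. ?u S * of_bool (card S = k \<and> 20 \<in> S)"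
  have R: "finite {1..19::nat}" "20 \<notin> {1..19::nat}" by auto
  have "(19::nat) choose 2 = 171" by (simp add: choose_two)
  moreover have "(19::nat) choose 3 = 969"
    using Suc_times_binomial[of 2 18] by (simp add: choose_two)
  \<comment> \<open>Here 209 = 171 + 2 * 19 and 1140 = 969 + 171, the last summands being the sets
    with 20. For \<open>n\<close> other elements the probabilities of 20 are 4/(n+3) and 3/(n+1),
    and the first is larger once n > 5.\<close>
  ultimately have N: "?N 2 = 209" "?N 3 = 1140"
    and M: "?M 2 = 38" "?M 3 = 171"
    using sum_almost_exch_card[OF R, where a = a and b = b and k = 1, folded E(3), unfolded Suc_1]
      sum_almost_exch_card[OF R, where a = a and b = b and k = 2, folded E(3)]
    by (simp_all add: a_def b_def del: sum_mult_of_bool_eq sum_of_bool_mult_eq)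
  \<comment> \<open>The up-set that witnesses the failure of domination: presence of the element
    20.\<close>
  define U where "U = {S. S \<subseteq> E \<and> 20 \<in> S}"
  have pk: "measure_pmf.prob \<mu> {S. card S = k} = ?N k / Z" for k
    by (simp add: prob)
  have trunc: "measure_pmf.prob (truncation \<mu> k) U = ?M k / ?N k" if "?N k > 0" for k
  proof -
    let ?X = "{S :: nat set. card S = k}"
    have pos: "measure_pmf.prob \<mu> ?X > 0" using that Z by (simp add: pk)
    have "measure_pmf.prob (truncation \<mu> k) U =
        (\<Sum>S\<in>Pow E. pmf (cond_pmf \<mu> ?X) S * of_bool (S \<in> U))"
      unfolding truncation_def by (rule prob_measure_on[OF E(1) measure_on_cond[OF on pos]])
    also have "\<dots> = (\<Sum>S\<in>Pow E. ?u S * of_bool (card S = k \<and> 20 \<in> S) / ?N k)"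
      using Z by (intro sum.cong) (auto simp: pmf_cond_positive[OF pos] pk \<mu> U_def)
    finally show ?thesis by (simp only: sum_divide_distrib)
  qed
  have "measure_pmf.prob \<mu> {S. card S = 2} * measure_pmf.prob \<mu> {S. card S = 2 + 1} > 0"
    using Z N by (simp add: pk)
  moreover have "\<not> stoch_dominated E (truncation \<mu> 2) (truncation \<mu> (2 + 1))"
  proof
    assume "stoch_dominated E (truncation \<mu> 2) (truncation \<mu> (2 + 1))"
    moreover have "U \<subseteq> Pow E" "\<forall>S\<in>U. \<forall>T\<in>Pow E. S \<subseteq> T \<longrightarrow> T \<in> U"
      by (auto simp: U_def)
    ultimately have "measure_pmf.prob (truncation \<mu> 2) U \<le> measure_pmf.prob (truncation \<mu> (2 + 1)) U"
      unfolding stoch_dominated_def by blast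
    then show False using trunc[of 2] trunc[of 3] by (simp add: N M)
  qed
  ultimately show ?thesis using on cna unfolding E_def by blast
qed

end
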